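(* Let $C$ be an $(n,k)_q$-MDS code over an alphabet $\mathcal{A}$ of size $q$ with $0\in\mathcal{A}$, and suppose that $C$ contains the all-zero codeword $\bar 0$. Consider the condition $(\star)$: $C$ has precisely $k$ distinct nonzero weights, namely $n,n-1,\ldots,n-k+1$; that is, the set of Hamming weights of the codewords of $C$ other than $\bar 0$ equals $\{n,n-1,\ldots,n-k+1\}$. If $k=1$, then $(\star)$ holds. If $k>1$, then $(\star)$ holds if and only if $n<q+k-1$.
   Context: Let $\mathcal{A}$ be a finite alphabet of size $q\ge 2$ ($q$ need not be a prime power) containing a distinguished symbol $0$, and let $1\le k\le n$ be integers. The Hamming distance $d(a,b)$ of $a,b\in\mathcal{A}^n$ is the number of coordinates in which they differ. An $(n,k)_q$ code is a subset $C\subseteq\mathcal{A}^n$ with $|C|=q^k$; no linearity is assumed. Its minimum distance $d$ is the minimum Hamming distance between distinct codewords; it satisfies the Singleton bound $d\le n-k+1$, and $C$ is called an $(n,k)_q$-MDS code if $d=n-k+1$. The Hamming weight of a word is the number of its nonzero coordinates, and $\bar 0$ is the word with all coordinates $0$. *)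

theory Defs
  imports Main
begin

definition words :: "'a set \<Rightarrow> nat \<Rightarrow> 'a list set" where
  "words A n = {w. length w = n \<and> set w \<subseteq> A}"

text \<open>The Hamming distance is only meant for words of equal length.\<close>

definition hamming_dist :: "'a list \<Rightarrow> 'a list \<Rightarrow> nat" where
  "hamming_dist a b = card {i. i < length a \<and> a ! i \<noteq> b ! i}"

text \<open>The parameter \<open>z\<close> is the distinguished zero symbol of the alphabet.\<close>

definition hamming_weight :: "'a \<Rightarrow> 'a list \<Rightarrow> nat" where
  "hamming_weight z w = card {i. i < length w \<and> w ! i \<noteq> z}"

definition zero_word :: "'a \<Rightarrow> nat \<Rightarrow> 'a list" where
  "zero_word z n = replicate n z"

definition is_code :: "'a set \<Rightarrow> nat \<Rightarrow> nat \<Rightarrow> 'a list set \<Rightarrow> bool" where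
  "is_code A n k C \<longleftrightarrow> C \<subseteq> words A n \<and> card C = card A ^ k"

text \<open>
  The set below is finite and nonempty whenever \<open>C\<close> is a finite code with at least two codewords;
  this is the case for \<open>is_code A n k C\<close> with \<open>A\<close> finite, \<open>card A \<ge> 2\<close> and \<open>k \<ge> 1\<close>.
\<close>

definition min_distance :: "'a list set \<Rightarrow> nat" where
  "min_distance C = Min {hamming_dist a b | a b. a \<in> C \<and> b \<in> C \<and> a \<noteq> b}"

text \<open>The subtraction is the intended one for \<open>k \<le> n\<close>.\<close>

definition is_MDS_code :: "'a set \<Rightarrow> nat \<Rightarrow> nat \<Rightarrow> 'a list set \<Rightarrow> bool" where
  "is_MDS_code A n k C \<longleftrightarrow> is_code A n k C \<and> min_distance C = n - k + 1"

definition nonzero_weights :: "'a \<Rightarrow> nat \<Rightarrow> 'a list set \<Rightarrow> nat set" where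
  "nonzero_weights z n C = hamming_weight z ` (C - {zero_word z n})"

end

theory Submission
  imports Defs "HOL-Library.FuncSet"
begin

text \<open>
  Any \<open>k\<close> coordinates of an MDS code form an information set, so prescribing the symbols on \<open>m \<le> k\<close>
  coordinates leaves exactly \<open>q ^ (k - m)\<close> codewords. Prescribe \<open>k - 2\<close> coordinates and look at the
  \<open>n - k + 2\<close> remaining ones: of the \<open>q\<^sup>2\<close> codewords left, \<open>q\<close> vanish at any given coordinate and
  one vanishes at any two given coordinates. If \<open>n - k + 2 \<le> q\<close>, these sets of \<open>q\<close> codewords
  cannot cover all \<open>q\<^sup>2\<close>, since two of them overlap; hence every weight above the minimum occurs.
  If \<open>n - k + 2 > q\<close> and all prescribed symbols are zero, the sets overlap only in the zero word and
  thus cover everything, so the weight \<open>n - k + 2\<close> does not occur.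
\<close>

section \<open>Prescribed symbols, zero sets and weights\<close>

definition agreeing :: "'a list set \<Rightarrow> nat set \<Rightarrow> (nat \<Rightarrow> 'a) \<Rightarrow> 'a list set" where
  "agreeing C I f = {c \<in> C. \<forall>i\<in>I. c ! i = f i}"

lemma agreeing_subset: "agreeing C I f \<subseteq> C"
  by (auto simp: agreeing_def)

lemma hamming_weight_zeros:
  assumes "length c = n"
  shows "hamming_weight z c = n - card {i. i < n \<and> c ! i = z}"
proof -
  have "{i. i < n \<and> c ! i \<noteq> z} = {..<n} - {i. i < n \<and> c ! i = z}" by auto
  then show ?thesis
    using assms by (simp add: hamming_weight_def card_Diff_subset subset_iff)
qed

lemma card_zeros:
  assumes "length c = n"
  shows "card {i. i < n \<and> c ! i = z} = n - hamming_weight z c"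
proof -
  have "card {i. i < n \<and> c ! i = z} \<le> card {..<n}" by (rule card_mono) auto
  then show ?thesis using hamming_weight_zeros[OF assms] by simp
qed

lemma hamming_dist_zero_word:
  "length c = n \<Longrightarrow> hamming_dist c (zero_word z n) = hamming_weight z c"
  unfolding hamming_dist_def hamming_weight_def zero_word_def
  by (rule arg_cong[where f = card]) auto

section \<open>Information sets and the number of codewords with prescribed symbols\<close>

locale mds_code =
  fixes A :: "'a set" and n k :: nat and C :: "'a list set"
  assumes finite_A: "finite A" and card_A: "2 \<le> card A"
    and k_pos: "1 \<le> k" and k_le: "k \<le> n"
    and mds: "is_MDS_code A n k C"
begin

lemma card_C: "card C = card A ^ k"
  using mds by (simp add: is_MDS_code_def is_code_def)

text \<open>An infinite set has cardinality 0, whereas \<open>card A ^ k\<close> is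
  positive.\<close>

lemma finite_C: "finite C"
  using card_C card_A by (intro card_ge_0_finite) simp

lemma finite_agreeing: "finite (agreeing C I f)"
  using finite_C agreeing_subset by (rule finite_subset[rotated])

lemma length_codeword: "c \<in> C \<Longrightarrow> length c = n"
  using mds by (auto simp: is_MDS_code_def is_code_def words_def)

lemma codeword_nth: "c \<in> C \<Longrightarrow> i < n \<Longrightarrow> c ! i \<in> A"
  using mds length_codeword nth_mem
  by (fastforce simp: is_MDS_code_def is_code_def words_def)

lemma dist_ge:
  assumes "a \<in> C" "b \<in> C" "a \<noteq> b"
  shows "n - k + 1 \<le> hamming_dist a b"
proof -
  have "finite {hamming_dist a b | a b. a \<in> C \<and> b \<in> C \<and> a \<noteq> b}"
    by (rule finite_subset[of _ "(\<lambda>(a, b). hamming_dist a b) ` (C \<times> C)"])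
      (use finite_C in auto)
  then have "min_distance C \<le> hamming_dist a b"
    unfolding min_distance_def by (rule Min_le) (use assms in blast)
  then show ?thesis using mds by (simp add: is_MDS_code_def)
qed

text \<open>Words agreeing on \<open>k\<close> coordinates differ in at most \<open>n - k\<close>
  places, which is below the minimum distance.\<close>

lemma codeword_eqI:
  assumes "a \<in> C" "b \<in> C" "I \<subseteq> {..<n}" "k \<le> card I" "\<And>i. i \<in> I \<Longrightarrow> a ! i = b ! i"
  shows "a = b"
proof (rule ccontr)
  assume "a \<noteq> b"
  then have "n - k + 1 \<le> hamming_dist a b" using dist_ge assms by blast
  also have "\<dots> \<le> card ({..<n} - I)"
    unfolding hamming_dist_def
    by (rule card_mono) (use assms length_codeword in auto)
  also have "\<dots> = n - card I"
    using assms(3) by (simp add: card_Diff_subset finite_subset)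
  finally show False using assms(4) k_le by linarith
qed

text \<open>Restriction to \<open>I\<close> is injective on \<open>C\<close> by
  \<open>codeword_eqI\<close>. Since \<open>C\<close> and the set of functions from \<open>I\<close>
  to \<open>A\<close> both have \<open>card A ^ k\<close> elements, it is also surjective.\<close>

lemma ex_agreeing:
  assumes "I \<subseteq> {..<n}" "card I = k" "f \<in> I \<rightarrow> A"
  shows "\<exists>c\<in>C. \<forall>i\<in>I. c ! i = f i"
proof -
  have fin: "finite I" using assms(1) finite_subset by blast
  let ?pr = "\<lambda>c. restrict ((!) c) I"
  have "inj_on ?pr C"
  proof (rule inj_onI)
    fix a b assume ab: "a \<in> C" "b \<in> C" "?pr a = ?pr b"
    have "a ! i = b ! i" if "i \<in> I" for i
      using fun_cong[OF ab(3), of i] that by simp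
    then show "a = b" using codeword_eqI[of a b I] ab assms(1,2) by simp
  qed
  then have "card (?pr ` C) = card (PiE I (\<lambda>_. A))"
    using card_C fin assms(2) by (simp add: card_image card_PiE)
  moreover have "?pr ` C \<subseteq> PiE I (\<lambda>_. A)"
    using assms(1) codeword_nth by auto
  ultimately have "?pr ` C = PiE I (\<lambda>_. A)"
    using fin finite_A by (intro card_subset_eq finite_PiE) auto
  moreover have "restrict f I \<in> PiE I (\<lambda>_. A)" using assms(3) by auto
  ultimately have "restrict f I \<in> ?pr ` C" by simp
  then obtain c where c: "c \<in> C" "restrict f I = ?pr c" by (rule imageE)
  have "c ! i = f i" if "i \<in> I" for i
    using fun_cong[OF c(2), of i] that by simp
  then show ?thesis using c(1) by blast
qed

text \<open>Induction on the number of prescriptions still missing from an information set: each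
  further coordinate splits the codewords by their symbol there, which contributes a factor
  \<open>card A\<close>.\<close>

lemma card_agreeing:
  assumes "I \<subseteq> {..<n}" "card I \<le> k" "f \<in> I \<rightarrow> A"
  shows "card (agreeing C I f) = card A ^ (k - card I)"
  using assms
proof (induction "k - card I" arbitrary: I f)
  case 0
  then have "card I = k" by simp
  then obtain c where c: "c \<in> C" "\<forall>i\<in>I. c ! i = f i"
    using ex_agreeing[of I f] 0(2,4) by blast
  have "x = c" if "x \<in> C" "\<forall>i\<in>I. x ! i = f i" for x
    by (rule codeword_eqI[of _ _ I]) (use that c 0(2) \<open>card I = k\<close> in auto)
  then have "agreeing C I f = {c}"
    unfolding agreeing_def using c by blast
  then show ?case using \<open>card I = k\<close> by simp
next
  case (Suc m)
  have fin: "finite I" using finite_subset[OF Suc.prems(1)] by simp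
  have "card I < card {..<n}" using Suc.hyps(2) k_le by simp
  then have "\<not> {..<n} \<subseteq> I" using card_mono[OF fin] by (meson not_less)
  then obtain j where j: "j < n" "j \<notin> I" by blast
  \<comment> \<open>Values of \<open>f\<close> outside \<open>I\<close> do not matter, so the update
    at \<open>j\<close> leaves the old prescriptions intact.\<close>
  have split: "agreeing C I f = (\<Union>a\<in>A. agreeing C (insert j I) (f(j := a)))"
    using j codeword_nth by (auto simp: agreeing_def split: if_splits)
  have "card (agreeing C I f) = (\<Sum>a\<in>A. card (agreeing C (insert j I) (f(j := a))))"
    unfolding split
    by (rule card_UN_disjoint)
      (use finite_A finite_agreeing in \<open>auto, auto simp: agreeing_def\<close>)
  also have "\<dots> = (\<Sum>a\<in>A. card A ^ m)"
  proof (rule sum.cong)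
    fix a assume "a \<in> A"
    have "m = k - card (insert j I)" using j fin Suc.hyps(2) by simp
    with \<open>a \<in> A\<close> show "card (agreeing C (insert j I) (f(j := a))) = card A ^ m"
      using Suc.hyps(1)[of "insert j I" "f(j := a)"] Suc.hyps(2) Suc.prems j fin by auto
  qed simp
  finally show ?case using Suc.hyps(2)[symmetric] by simp
qed

end

section \<open>Weights of an MDS code that contains the zero word\<close>

locale mds_code_with_zero = mds_code +
  fixes z :: 'a
  assumes z_in: "z \<in> A" and zero_in: "zero_word z n \<in> C"
begin

lemma zero_word_agreeing: "I \<subseteq> {..<n} \<Longrightarrow> zero_word z n \<in> agreeing C I (\<lambda>_. z)"
  using zero_in by (auto simp: agreeing_def zero_word_def)

text \<open>The weight of a codeword is its distance to the zero word, itself a codeword.\<close>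

lemma nonzero_weights_subset: "nonzero_weights z n C \<subseteq> {n - k + 1..n}"
proof
  fix w assume "w \<in> nonzero_weights z n C"
  then obtain c where c: "c \<in> C" "c \<noteq> zero_word z n" "w = hamming_weight z c"
    by (auto simp: nonzero_weights_def)
  then show "w \<in> {n - k + 1..n}"
    using dist_ge[OF c(1) zero_in c(2)] length_codeword[OF c(1)] hamming_weight_zeros[of c n z]
      hamming_dist_zero_word[of c n z] by simp
qed

text \<open>Prescribing \<open>k - 1\<close> zeros leaves \<open>card A\<close> codewords, hence a
  nonzero one. Its zeros bound its weight from above, and the minimum distance bounds it from
  below.\<close>

lemma min_weight: "n - k + 1 \<in> nonzero_weights z n C"
proof -
  let ?I = "{..<k - 1}"
  have I: "?I \<subseteq> {..<n}" using k_le by auto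
  have "card (agreeing C ?I (\<lambda>_. z)) = card A"
    using card_agreeing[of ?I "\<lambda>_. z"] k_pos I z_in by simp
  then have "\<not> agreeing C ?I (\<lambda>_. z) \<subseteq> {zero_word z n}"
    using card_A card_mono[of "{zero_word z n}" "agreeing C ?I (\<lambda>_. z)"] by auto
  then obtain c where c: "c \<in> C" "c \<noteq> zero_word z n" "\<forall>i<k - 1. c ! i = z"
    by (auto simp: agreeing_def)
  have "card ?I \<le> card {i. i < n \<and> c ! i = z}"
    by (rule card_mono) (use c(3) k_le in auto)
  then have "hamming_weight z c \<le> n - k + 1"
    using hamming_weight_zeros[OF length_codeword[OF c(1)], of z] k_pos k_le by simp
  moreover have "hamming_weight z c \<in> nonzero_weights z n C"
    using c by (auto simp: nonzero_weights_def)
  ultimately show ?thesis using nonzero_weights_subset by fastforce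
qed

text \<open>A codeword \<open>c\<close> of this weight would have exactly \<open>k - 2\<close>
  zeros. Adding one more zero in each possible place gives disjoint families of nonzero codewords,
  all avoiding \<open>c\<close>, and together these are too many.\<close>

lemma weight_missing:
  assumes "2 \<le> k" "card A + k - 1 \<le> n"
  shows "n - k + 2 \<notin> nonzero_weights z n C"
proof
  assume "n - k + 2 \<in> nonzero_weights z n C"
  then obtain c where c: "c \<in> C" "c \<noteq> zero_word z n" "hamming_weight z c = n - k + 2"
    unfolding nonzero_weights_def by (elim imageE DiffE) simp
  define T where "T = {i. i < n \<and> c ! i = z}"
  define J where "J = {..<n} - T"
  define E where "E j = agreeing C (insert j T) (\<lambda>_. z) - {zero_word z n}" for j
  have T: "T \<subseteq> {..<n}" "finite T" by (auto simp: T_def)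
  have card_T: "card T = k - 2"
    using card_zeros[OF length_codeword[OF c(1)], of z] c(3) assms(1) k_le by (simp add: T_def)
  have card_J: "card A + 1 \<le> card J"
    using T card_T assms k_le by (simp add: J_def card_Diff_subset)
  have card_E: "card (E j) = card A - 1" if "j \<in> J" for j
  proof -
    have "card (insert j T) = k - 1" using that T card_T assms by (simp add: J_def)
    moreover have j: "insert j T \<subseteq> {..<n}" using that T by (auto simp: J_def)
    ultimately have "card (agreeing C (insert j T) (\<lambda>_. z)) = card A"
      using card_agreeing[of "insert j T" "\<lambda>_. z"] k_pos z_in by simp
    then show ?thesis using zero_word_agreeing[OF j] by (simp add: E_def)
  qed
  \<comment> \<open>A common element vanishes on \<open>k\<close> coordinates, as the zero word
    does; this is why \<open>E\<close> omits the zero word.\<close>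
  have disj: "E i \<inter> E j = {}" if "i \<in> J" "j \<in> J" "i \<noteq> j" for i j
  proof -
    have "x = zero_word z n" if "x \<in> E i" "x \<in> E j" for x
      by (rule codeword_eqI[where I = "insert i (insert j T)"])
        (use that \<open>i \<in> J\<close> \<open>j \<in> J\<close> \<open>i \<noteq> j\<close> T card_T assms zero_in
          in \<open>auto simp: E_def J_def agreeing_def zero_word_def\<close>)
    then show ?thesis by (auto simp: E_def)
  qed
  have "(card A + 1) * (card A - 1) \<le> card J * (card A - 1)"
    using card_J by (rule mult_le_mono1)
  also have "\<dots> = card (\<Union>j\<in>J. E j)"
    by (subst card_UN_disjoint) (use disj card_E finite_agreeing in \<open>auto simp: E_def J_def\<close>)
  \<comment> \<open>No \<open>E j\<close> contains \<open>c\<close>, because \<open>c\<close> is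
    nonzero at every \<open>j\<close> in \<open>J\<close>.\<close>
  also have "\<dots> \<le> card (agreeing C T (\<lambda>_. z) - {zero_word z n, c})"
    by (rule card_mono)
      (simp add: finite_agreeing, auto simp: E_def J_def T_def agreeing_def)
  also have "\<dots> = card A ^ 2 - 2"
  proof -
    have "card (agreeing C T (\<lambda>_. z)) = card A ^ 2"
      using card_agreeing[of T "\<lambda>_. z"] T card_T assms(1) z_in by simp
    moreover have "{zero_word z n, c} \<subseteq> agreeing C T (\<lambda>_. z)"
      using zero_word_agreeing[OF T(1)] c by (auto simp: agreeing_def T_def)
    ultimately show ?thesis using c(2) by (simp add: card_Diff_subset)
  qed
  finally have "(card A + 1) * (card A - 1) \<le> card A ^ 2 - 2" .
  \<comment> \<open>The left side is \<open>card A ^ 2 - 1\<close>. Substituting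
    \<open>m + 2\<close> eliminates the truncated subtractions.\<close>
  moreover obtain m where "card A = m + 2" using card_A by (metis add.commute le_Suc_ex)
  ultimately show False by (simp add: power2_eq_square)
qed

text \<open>Besides weights, this controls the exact position of the zeros, as long as there are at
  most \<open>k - 2\<close> of them.\<close>

lemma ex_codeword_zeros:
  assumes "2 \<le> k" "n < card A + k - 1" "T \<subseteq> {..<n}" "card T \<le> k - 2"
  shows "\<exists>c\<in>C. {i. i < n \<and> c ! i = z} = T"
proof -
  obtain y where y: "y \<in> A" "y \<noteq> z"
    using card_A finite_A by (metis card_le_Suc0_iff_eq not_less_eq_eq numeral_2_eq_2)
  obtain P where P: "T \<subseteq> P" "P \<subseteq> {..<n}" "card P = k - 2"
    using exists_subset_between[of T "k - 2" "{..<n}"] assms k_le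
    by (metis card_lessThan diff_le_self finite_lessThan le_trans[of "k - 2" k n])
  have finP: "finite P" using P(2) finite_subset by blast
  \<comment> \<open>The padding coordinates in \<open>P - T\<close> receive the nonzero symbol
    \<open>y\<close>. Outside \<open>P\<close> the value is \<open>z\<close>, so \<open>E j\<close>
    collects the codewords with an unwanted zero at \<open>j\<close>.\<close>
  define f where "f i = (if i \<in> P - T then y else z)" for i
  define J where "J = {..<n} - P"
  define E where "E j = agreeing C (insert j P) f" for j
  have f: "f \<in> I \<rightarrow> A" for I using y z_in by (auto simp: f_def)
  have card_J: "card J = n - k + 2"
    using P finP assms(1) k_le by (simp add: J_def card_Diff_subset)
  have card_E: "card (E j) = card A" if "j \<in> J" for j
    using card_agreeing[OF _ _ f, of "insert j P"] that P finP assms(1)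
    by (simp add: E_def J_def)
  have card_P: "card (agreeing C P f) = card A ^ 2"
    using card_agreeing[of P f] f P assms(1) by simp
  have "2 \<le> card J" using card_J by simp
  then obtain i j where ij: "i \<in> J" "j \<in> J" "i \<noteq> j"
    by (metis card_le_Suc0_iff_eq card.infinite not_less_eq_eq numeral_2_eq_2 zero_le)
  have sub: "insert i (insert j P) \<subseteq> {..<n}" and card_ij: "card (insert i (insert j P)) = k"
    using ij P finP assms(1) by (auto simp: J_def)
  obtain x where x: "x \<in> E i" "x \<in> E j"
    using ex_agreeing[OF sub card_ij f] by (auto simp: E_def agreeing_def)
  have "card (\<Union>j\<in>J. E j) < card A ^ 2"
  proof -
    have finJ: "finite J" by (simp add: J_def)
    \<comment> \<open>Since \<open>x\<close> is still covered by \<open>E j\<close>, it may be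
      dropped from \<open>E i\<close>. This makes the bound strict even when
      \<open>card J = card A\<close>.\<close>
    have "(\<Union>j\<in>J. E j) = (\<Union>l\<in>J - {i}. E l) \<union> (E i - {x})"
      using ij x by auto
    then have "card (\<Union>j\<in>J. E j) \<le> card (\<Union>l\<in>J - {i}. E l) + card (E i - {x})"
      by (simp add: card_Un_le)
    also have "card (\<Union>l\<in>J - {i}. E l) \<le> (\<Sum>l\<in>J - {i}. card (E l))"
      using finJ by (intro card_UN_le) simp
    also have "\<dots> = (card J - 1) * card A"
      using card_E ij(1) by simp
    also have "card (E i - {x}) = card A - 1"
      using card_E ij(1) x(1) by simp
    also have "(card J - 1) * card A + (card A - 1) < (card J - 1) * card A + card A"
      using card_A by simp
    also have "\<dots> = card J * card A"
      using card_J by simp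
    also have "\<dots> \<le> card A ^ 2"
      unfolding power2_eq_square by (rule mult_le_mono1) (use card_J assms(1,2) k_le in linarith)
    finally show ?thesis by simp
  qed
  then have "\<not> agreeing C P f \<subseteq> (\<Union>j\<in>J. E j)"
    using card_P card_mono[of "\<Union>j\<in>J. E j" "agreeing C P f"] finite_agreeing by (auto simp: E_def J_def)
  then obtain c where c: "c \<in> agreeing C P f" "\<And>j. j \<in> J \<Longrightarrow> c \<notin> E j" by blast
  have "{i. i < n \<and> c ! i = z} = T"
    using c P y by (auto simp: E_def J_def agreeing_def f_def split: if_splits)
  then show ?thesis using c(1) agreeing_subset by blast
qed

text \<open>The first \<open>n - w\<close> coordinates serve as zero set. The bound on
  \<open>w\<close> says that these are at most \<open>k - 2\<close>, so the minimum weight, with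
  \<open>k - 1\<close> zeros, is left to \<open>min_weight\<close>.\<close>

lemma weight_occurs:
  assumes "2 \<le> k" "n < card A + k - 1" "n - k + 2 \<le> w" "w \<le> n"
  shows "w \<in> nonzero_weights z n C"
proof -
  have "\<exists>c\<in>C. {i. i < n \<and> c ! i = z} = {..<n - w}"
    by (rule ex_codeword_zeros) (use assms in auto)
  then obtain c where c: "c \<in> C" "{i. i < n \<and> c ! i = z} = {..<n - w}" by blast
  then have "hamming_weight z c = w"
    using hamming_weight_zeros[OF length_codeword[OF c(1)], of z] assms(4) by simp
  moreover have "c \<noteq> zero_word z n"
  proof
    assume "c = zero_word z n"
    then have "hamming_weight z c = 0" by (simp add: hamming_weight_def zero_word_def)
    then show False using calculation assms(3) by simp
  qed
  ultimately show ?thesis using c(1) by (auto simp: nonzero_weights_def)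
qed

end

theorem corollary2:
  fixes A :: "'a set" and z :: 'a and C :: "'a list set" and q n k :: nat
  assumes "finite A" and "card A = q" and "q \<ge> 2" and "z \<in> A"
    and "1 \<le> k" and "k \<le> n"
    and "is_MDS_code A n k C"
    and "zero_word z n \<in> C"
  shows "(k = 1 \<longrightarrow> nonzero_weights z n C = {n - k + 1..n}) \<and>
         (k > 1 \<longrightarrow> (nonzero_weights z n C = {n - k + 1..n} \<longleftrightarrow> n < q + k - 1))"
proof -
  interpret mds_code_with_zero A n k C z
    using assms by unfold_locales auto
  show ?thesis
  proof (intro conjI impI iffI)
    assume "k = 1"
    then show "nonzero_weights z n C = {n - k + 1..n}"
      using nonzero_weights_subset min_weight k_le by auto
  next
    assume "1 < k" and eq: "nonzero_weights z n C = {n - k + 1..n}"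
    \<comment> \<open>This weight is within range because \<open>k > 1\<close>, and it is the one
      that \<open>weight_missing\<close> excludes for large \<open>n\<close>.\<close>
    then have "n - k + 2 \<in> nonzero_weights z n C" using k_le by auto
    then show "n < q + k - 1"
      using weight_missing \<open>1 < k\<close> assms(2) by fastforce
  next
    assume k: "1 < k" and n: "n < q + k - 1"
    have "w \<in> nonzero_weights z n C" if "w \<in> {n - k + 1..n}" for w
    proof (cases "w = n - k + 1")
      case True
      then show ?thesis using min_weight by simp
    next
      case False
      then show ?thesis using weight_occurs that k n assms(2) by simp
    qed
    then show "nonzero_weights z n C = {n - k + 1..n}"
      using nonzero_weights_subset by blast
  qed
qed

end
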